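(* Consider the one-parameter family $E: y^2=x^3-t^2x+t^4$ with parameter $t$. Then for every odd prime $p$ the (unnormalized) first moment of the family at $p$ is $$\sum_{t \bmod p} a_t(p)=-2p.$$
   Context: For an odd prime $p$, $\left(\frac{\cdot}{p}\right)$ denotes the Legendre symbol, with $\left(\frac{u}{p}\right)=0$ if $p\mid u$. For a family $y^2=f_t(x)$ with $f_t(x)$ a cubic polynomial in $x$ with integer coefficients depending polynomially on $t$, one sets $a_t(p):=p-\#\{(x,y)\in(\mathbb{Z}/p\mathbb{Z})^2: y^2\equiv f_t(x) \bmod p\}=-\sum_{x \bmod p}\left(\frac{f_t(x)}{p}\right)$. No condition is imposed on the specialization $t$: all residues $t \bmod p$ are included, also those for which the curve is singular. *)

theory Defs
  imports "HOL-Number_Theory.Number_Theory" "HOL-Computational_Algebra.Polynomial"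
begin

text \<open>
  Residue classes modulo \<open>p\<close> are represented by the integers in \<open>{0..<p}\<close>.
  A family \<open>y\<^sup>2 = f\<^sub>t(x)\<close> is given by the map from an integer \<open>t\<close> to the polynomial \<open>f\<^sub>t\<close>
  in \<open>x\<close>.
\<close>

definition affine_points :: "int poly \<Rightarrow> nat \<Rightarrow> (int \<times> int) set" where
  "affine_points f p =
     {(x, y). x \<in> {0..<int p} \<and> y \<in> {0..<int p} \<and> [y\<^sup>2 = poly f x] (mod int p)}"

definition trace_at :: "int poly \<Rightarrow> nat \<Rightarrow> int" where
  "trace_at f p = int p - int (card (affine_points f p))"

text \<open>Singular fibres are included.\<close>

definition first_moment :: "(int \<Rightarrow> int poly) \<Rightarrow> nat \<Rightarrow> int" where
  "first_moment F p = (\<Sum>t\<in>{0..<int p}. trace_at (F t) p)"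

definition family_E :: "int \<Rightarrow> int poly" where
  "family_E t = [:t ^ 4, - (t\<^sup>2), 0, 1:]"

lemma poly_family_E: "poly (family_E t) x = x ^ 3 - t\<^sup>2 * x + t ^ 4"
  by (simp add: family_E_def algebra_simps power2_eq_square power3_eq_cube power4_eq_xxxx)

lemma card_sqrt_mod:
  assumes "prime p" "odd p"
  shows "int (card {y \<in> {0..<int p}. [y\<^sup>2 = a] (mod int p)}) = 1 + Legendre a (int p)"
proof -
  let ?p = "int p"
  let ?S = "{y \<in> {0..<?p}. [y\<^sup>2 = a] (mod ?p)}"
  have pr: "prime ?p" using assms by simp
  have p2: "?p > 2" using assms prime_gt_1_nat[of p] by (cases "p = 2") auto
  consider (z) "[a = 0] (mod ?p)" | (r) "\<not> [a = 0] (mod ?p)" "QuadRes ?p a"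
    | (n) "\<not> [a = 0] (mod ?p)" "\<not> QuadRes ?p a" by blast
  then show ?thesis
  proof cases
    case z
    have "y = 0" if "y \<in> ?S" for y
    proof -
      have "?p dvd y\<^sup>2" using that z by (metis (lifting) mem_Collect_eq cong_trans cong_0_iff)
      then have "?p dvd y" using pr prime_dvd_power by blast
      then show ?thesis using that by (auto dest: zdvd_not_zless simp: order_le_less)
    qed
    moreover have "0 \<in> ?S" using z p2 by (auto simp: cong_sym_eq)
    ultimately have "?S = {0}" by blast
    then have "card ?S = 1" by simp
    then show ?thesis using z by (simp add: Legendre_def)
  next
    case r
    then obtain y0 where y0: "[y0\<^sup>2 = a] (mod ?p)" unfolding QuadRes_def by blast
    define u where "u = y0 mod ?p"
    have u: "[u\<^sup>2 = a] (mod ?p)" using y0 unfolding u_def cong_def by (simp add: power_mod)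
    have ur: "0 \<le> u" "u < ?p" using p2 by (auto simp: u_def)
    have u0: "u \<noteq> 0" using u r(1) by (auto simp: cong_sym_eq)
    have une: "u \<noteq> ?p - u" using assms by (metis add_diff_cancel_left' diff_add_cancel
        even_of_nat even_add)
    have u': "[(?p - u)\<^sup>2 = a] (mod ?p)"
    proof -
      have "(?p - u)\<^sup>2 = u\<^sup>2 + ?p * (?p - 2 * u)" by (simp add: power2_eq_square algebra_simps)
      then have "[(?p - u)\<^sup>2 = u\<^sup>2] (mod ?p)" by (simp add: cong_def)
      then show ?thesis using u cong_trans by blast
    qed
    have "y = u \<or> y = ?p - u" if "y \<in> ?S" for y
    proof -
      have "[y\<^sup>2 = u\<^sup>2] (mod ?p)" using that u by (metis (lifting) mem_Collect_eq cong_trans cong_sym)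
      then have "?p dvd y\<^sup>2 - u\<^sup>2" by (simp add: cong_iff_dvd_diff)
      moreover have "y\<^sup>2 - u\<^sup>2 = (y - u) * (y + u)" by (simp add: power2_eq_square algebra_simps)
      ultimately have "?p dvd y - u \<or> ?p dvd y + u" using pr by (simp add: prime_dvd_mult_iff)
      then show ?thesis
      proof
        assume "?p dvd y - u"
        then have "[y = u] (mod ?p)" by (simp add: cong_iff_dvd_diff)
        then show ?thesis using that ur by (simp add: cong_def)
      next
        assume "?p dvd y + u"
        then have "[y = ?p - u] (mod ?p)"
          by (simp add: cong_iff_dvd_diff) (metis add_diff_eq diff_diff_eq2 dvd_diff dvd_refl
              diff_add_eq)
        then have "y = ?p - u" using that ur u0 by (intro cong_less_imp_eq_int[of y ?p]) auto
        then show ?thesis ..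
      qed
    qed
    then have "?S = {u, ?p - u}" using u u' ur u0 by auto
    then have "card ?S = 2" using une by simp
    then show ?thesis using r by (simp add: Legendre_def)
  next
    case n
    then have "?S = {}" unfolding QuadRes_def by blast
    then have "card ?S = 0" by (simp only: card.empty)
    then show ?thesis using n by (simp add: Legendre_def)
  qed
qed

lemma trace_at_eq_Legendre_sum:
  assumes "prime p" "odd p"
  shows "trace_at f p = - (\<Sum>x\<in>{0..<int p}. Legendre (poly f x) (int p))"
proof -
  have "affine_points f p =
      (SIGMA x:{0..<int p}. {y \<in> {0..<int p}. [y\<^sup>2 = poly f x] (mod int p)})"
    by (auto simp: affine_points_def)
  then have "int (card (affine_points f p)) =
      (\<Sum>x\<in>{0..<int p}. int (card {y \<in> {0..<int p}. [y\<^sup>2 = poly f x] (mod int p)}))"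
    by (simp only:) (subst card_SigmaI, auto simp del: atLeastLessThan_iff)
  also have "\<dots> = (\<Sum>x\<in>{0..<int p}. 1 + Legendre (poly f x) (int p))"
    using card_sqrt_mod[OF assms] by simp
  finally show ?thesis by (simp add: trace_at_def sum.distrib)
qed

end

theory Submission
  imports Defs
begin

text \<open>
  For \<open>t \<noteq> 0\<close> the substitution \<open>x = t u\<close> turns \<open>x\<^sup>3 - t\<^sup>2 x + t\<^sup>4\<close> into \<open>t\<^sup>3 (t + u\<^sup>3 - u)\<close>, so the
  moment is minus the sum over \<open>u\<close> of the character sums of \<open>t (t + c)\<close> over \<open>t\<close>, where
  \<open>c = u\<^sup>3 - u\<close>. Such a sum is \<open>p - 1\<close> if \<open>c = 0\<close>, which happens for the three values
  \<open>u = 0, 1, -1\<close>, and \<open>-1\<close> otherwise.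
\<close>

text \<open>Since \<open>a\<close> is invertible modulo \<open>n\<close>, the map \<open>?g\<close>
  permutes the residues. Periodicity makes \<open>h\<close> a function of residue classes, so
  reducing its argument modulo \<open>n\<close> is harmless.\<close>

lemma sum_residues_affine:
  fixes n a b :: int and h :: "int \<Rightarrow> 'a::comm_monoid_add"
  assumes "n > 0" and "coprime a n"
    and periodic: "\<And>x y. [x = y] (mod n) \<Longrightarrow> h x = h y"
  shows "(\<Sum>x\<in>{0..<n}. h (a * x + b)) = (\<Sum>x\<in>{0..<n}. h x)"
proof -
  let ?g = "\<lambda>x. (a * x + b) mod n"
  have inj: "inj_on ?g {0..<n}"
  proof (rule inj_onI)
    fix x y assume xy: "x \<in> {0..<n}" "y \<in> {0..<n}" and "?g x = ?g y"
    then have "[a * x + b = a * y + b] (mod n)" by (simp add: cong_def)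
    then have "[x = y] (mod n)"
      using assms(2) by (simp add: cong_add_rcancel cong_mult_lcancel)
    then show "x = y" using xy cong_less_imp_eq_int by auto
  qed
  moreover have "?g ` {0..<n} \<subseteq> {0..<n}" using assms(1) by auto
  ultimately have "?g ` {0..<n} = {0..<n}" by (simp add: endo_inj_surj)
  then have "(\<Sum>x\<in>{0..<n}. h x) = (\<Sum>x\<in>{0..<n}. h (?g x))"
    using sum.reindex[OF inj, of h] by simp
  also have "\<dots> = (\<Sum>x\<in>{0..<n}. h (a * x + b))"
    by (intro sum.cong refl periodic) (simp add: cong_def)
  finally show ?thesis ..
qed

lemma sum_residues_if_dvd:
  fixes p :: nat and f :: "int \<Rightarrow> int" and a b :: int
  shows "(\<Sum>x\<in>{0..<int p}. if int p dvd f x then a else b) =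
    (a - b) * int (card {x \<in> {0..<int p}. int p dvd f x}) + b * int p"
proof -
  have "(\<Sum>x\<in>{0..<int p}. if int p dvd f x then a else b) =
      (\<Sum>x\<in>{0..<int p}. (if int p dvd f x then a - b else 0) + b)"
    by (intro sum.cong) auto
  also have "\<dots> = (\<Sum>x\<in>{x \<in> {0..<int p}. int p dvd f x}. a - b) + (\<Sum>x\<in>{0..<int p}. b)"
    by (simp only: sum.distrib sum.inter_filter[OF finite_atLeastLessThan_int])
  finally show ?thesis by (simp add: mult.commute)
qed

lemma Legendre_cong:
  assumes "[a = b] (mod p)"
  shows "Legendre a p = Legendre b p"
proof -
  have "[x = a] (mod p) \<longleftrightarrow> [x = b] (mod p)" for x
    using assms by (auto simp: cong_def)
  moreover have "[a = 0] (mod p) \<longleftrightarrow> [b = 0] (mod p)"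
    using assms by (auto simp: cong_def)
  ultimately show ?thesis by (simp add: Legendre_def QuadRes_def)
qed

lemma Legendre_cases: "Legendre a p \<in> {-1, 0, 1}"
  by (simp add: Legendre_def)

context
  fixes p :: nat
  assumes prime_p: "prime p" and odd_p: "odd p"
begin

lemma p_gt_2: "2 < p"
  using prime_p odd_p prime_gt_1_nat[of p] by (cases "p = 2") auto

text \<open>Euler's criterion gives the identity modulo \<open>p\<close>. Both sides lie in {-1, 0,
  1}, so they differ by at most 2 < \<open>p\<close> and must be equal.\<close>

lemma Legendre_mult: "Legendre (a * b) p = Legendre a p * Legendre b p"
proof -
  note euler = euler_criterion[OF prime_p p_gt_2]
  have "[Legendre (a * b) p = Legendre a p * Legendre b p] (mod p)"
    using cong_mult[OF euler[of a] euler[of b]] euler[of "a * b"]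
    by (metis power_mult_distrib cong_trans cong_sym)
  then have "int p dvd Legendre (a * b) p - Legendre a p * Legendre b p" (is "_ dvd ?d")
    by (simp add: cong_iff_dvd_diff)
  moreover have "\<bar>?d\<bar> \<le> 2"
    using Legendre_cases[of a p] Legendre_cases[of b p] Legendre_cases[of "a * b" p] by auto
  ultimately have "?d = 0" using p_gt_2 zdvd_imp_le[of p "\<bar>?d\<bar>"] by fastforce
  then show ?thesis by simp
qed

lemma Legendre_cube: "Legendre (a ^ 3) p = Legendre a p"
  using Legendre_cases[of a p] by (auto simp: power3_eq_cube Legendre_mult)

lemma Legendre_square: "Legendre a p * Legendre a p = (if int p dvd a then 0 else 1)"
  by (auto simp: Legendre_def cong_0_iff)

lemma coprime_p_iff: "coprime a (int p) \<longleftrightarrow> \<not> int p dvd a"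
  using prime_p
  by (metis coprime_commute coprime_absorb_left not_prime_unit prime_imp_coprime prime_nat_int_transfer)

text \<open>The points on \<open>y\<^sup>2 = x\<close> are parametrised by \<open>y\<close>, so there are \<open>p\<close> of them.\<close>

lemma sum_Legendre: "(\<Sum>x\<in>{0..<int p}. Legendre x p) = 0"
proof -
  have "affine_points [:0, 1:] p = (\<lambda>y. (y\<^sup>2 mod int p, y)) ` {0..<int p}"
    using p_gt_2 by (auto simp: affine_points_def cong_def)
  also have "card \<dots> = card {0..<int p}"
    by (rule card_image) (auto simp: inj_on_def)
  finally have "trace_at [:0, 1:] p = 0" by (simp add: trace_at_def)
  then show ?thesis using trace_at_eq_Legendre_sum[OF prime_p odd_p, of "[:0, 1:]"] by simp
qed

lemma card_multiples: "card {x \<in> {0..<int p}. int p dvd x} = 1"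
proof -
  have "{x \<in> {0..<int p}. int p dvd x} = {0}"
    using p_gt_2 by (auto dest: zdvd_imp_le simp: order_le_less)
  then show ?thesis by simp
qed

text \<open>If \<open>p\<close> divides \<open>c\<close>, the summands are squares of symbols.
  Otherwise rescaling \<open>t = c * s\<close> pulls out the square of the symbol of
  \<open>c\<close>, which is 1, so the sum does not depend on \<open>c\<close>.\<close>

lemma sum_Legendre_shift:
  "(\<Sum>t\<in>{0..<int p}. Legendre t p * Legendre (t + c) p) = (if int p dvd c then int p - 1 else - 1)"
proof -
  define T where "T c = (\<Sum>t\<in>{0..<int p}. Legendre t p * Legendre (t + c) p)" for c
  have T0: "T c = int p - 1" if "int p dvd c" for c
  proof -
    have "Legendre (t + c) p = Legendre t p" for t
      by (rule Legendre_cong) (use that in \<open>simp add: cong_iff_dvd_diff\<close>)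
    then show ?thesis
      using sum_residues_if_dvd[of p "\<lambda>x. x" 0 1, unfolded card_multiples]
      by (simp add: T_def Legendre_square)
  qed
  have T1: "T c = T 1" if c: "\<not> int p dvd c" for c
  proof -
    have "T c = (\<Sum>s\<in>{0..<int p}. Legendre (c * s + 0) p * Legendre (c * s + 0 + c) p)"
      unfolding T_def
      by (rule sum_residues_affine[symmetric])
        (use p_gt_2 c in \<open>auto simp: coprime_p_iff intro!: arg_cong2[of _ _ _ _ "(*)"] Legendre_cong cong_add\<close>)
    also have "\<dots> = (\<Sum>s\<in>{0..<int p}. (Legendre c p * Legendre c p) * (Legendre s p * Legendre (s + 1) p))"
    proof (intro sum.cong refl)
      fix s
      have "c * s + 0 + c = c * (s + 1)" by (simp add: algebra_simps)
      then show "Legendre (c * s + 0) p * Legendre (c * s + 0 + c) p =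
          (Legendre c p * Legendre c p) * (Legendre s p * Legendre (s + 1) p)"
        by (simp only: add_0_right Legendre_mult mult_ac)
    qed
    also have "\<dots> = T 1" using c by (simp add: Legendre_square T_def)
    finally show ?thesis .
  qed
  \<comment> \<open>Averaging over \<open>c\<close> determines the common value \<open>T 1\<close>.\<close>
  have "(\<Sum>c\<in>{0..<int p}. T c) = (\<Sum>t\<in>{0..<int p}. Legendre t p * (\<Sum>c\<in>{0..<int p}. Legendre (1 * c + t) p))"
    unfolding T_def by (subst sum.swap) (simp add: sum_distrib_left add.commute)
  also have "\<dots> = 0"
  proof -
    \<comment> \<open>For fixed \<open>t\<close> the inner sum runs over a translate of all
      residues, so it is a complete character sum.\<close>
    have "(\<Sum>c\<in>{0..<int p}. Legendre (1 * c + t) p) = (\<Sum>x\<in>{0..<int p}. Legendre x p)" for t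
      by (rule sum_residues_affine) (use p_gt_2 in \<open>auto intro: Legendre_cong\<close>)
    then show ?thesis by (simp only: sum_Legendre mult_zero_right sum.neutral_const)
  qed
  also have "(\<Sum>c\<in>{0..<int p}. T c) = (\<Sum>c\<in>{0..<int p}. if int p dvd c then int p - 1 else T 1)"
    using T0 T1 by (intro sum.cong refl) auto
  \<comment> \<open>The residue 0 contributes \<open>p - 1\<close>, and each of the other
    \<open>p - 1\<close> residues contributes \<open>T 1\<close>.\<close>
  also have "\<dots> = (int p - 1) * (1 + T 1)"
    using sum_residues_if_dvd[of p "\<lambda>x. x" "int p - 1" "T 1", unfolded card_multiples]
    by (simp add: algebra_simps)
  finally have "T 1 = - 1" using p_gt_2 by auto
  then show ?thesis using T0 T1 unfolding T_def by auto
qed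

text \<open>For invertible \<open>t\<close>, substitute \<open>x = t * u\<close>; the factor
  \<open>t ^ 3\<close> has the same symbol as \<open>t\<close>.\<close>

lemma fiber_Legendre_sum:
  "(\<Sum>x\<in>{0..<int p}. Legendre (poly (family_E t) x) p) =
   (\<Sum>u\<in>{0..<int p}. Legendre t p * Legendre (t + (u ^ 3 - u)) p)"
proof (cases "int p dvd t")
  \<comment> \<open>The fibre degenerates to \<open>y^2 = x^3\<close>, whose character sum is that
    of \<open>x\<close>, namely 0. The right side vanishes through its factor
    \<open>Legendre t p\<close>, so the formula covers this fibre too.\<close>
  case True
  have "Legendre (poly (family_E t) x) p = Legendre x p" for x
  proof -
    have "[poly (family_E t) x = x ^ 3] (mod int p)"
      using True by (auto simp: poly_family_E cong_iff_dvd_diff power2_eq_square power4_eq_xxxx)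
    then show ?thesis using Legendre_cong Legendre_cube by metis
  qed
  moreover have "Legendre t p = 0" using True by (simp add: Legendre_def cong_0_iff)
  ultimately show ?thesis by (simp add: sum_Legendre)
next
  case False
  have "(\<Sum>x\<in>{0..<int p}. Legendre (poly (family_E t) x) p) =
      (\<Sum>u\<in>{0..<int p}. Legendre (poly (family_E t) (t * u + 0)) p)"
    by (rule sum_residues_affine[symmetric])
      (use p_gt_2 False in \<open>auto simp: coprime_p_iff poly_family_E
        intro!: Legendre_cong cong_add cong_diff cong_mult cong_pow\<close>)
  also have "\<dots> = (\<Sum>u\<in>{0..<int p}. Legendre t p * Legendre (t + (u ^ 3 - u)) p)"
  proof (intro sum.cong refl)
    fix u
    have "poly (family_E t) (t * u + 0) = t ^ 3 * (t + (u ^ 3 - u))"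
      by (simp add: poly_family_E algebra_simps power2_eq_square power3_eq_cube power4_eq_xxxx)
    then show "Legendre (poly (family_E t) (t * u + 0)) p =
        Legendre t p * Legendre (t + (u ^ 3 - u)) p"
      by (simp only: Legendre_mult Legendre_cube)
  qed
  finally show ?thesis .
qed

text \<open>The factorisation \<open>u * (u - 1) * (u + 1)\<close> gives the roots 0, 1 and -1, the
  last represented by \<open>p - 1\<close>. They are distinct because \<open>p > 2\<close>.\<close>

lemma card_roots_cube_minus_self: "card {u \<in> {0..<int p}. int p dvd u ^ 3 - u} = 3"
proof -
  have "int p dvd u ^ 3 - u \<longleftrightarrow> u = 0 \<or> u = 1 \<or> u = int p - 1" if u: "u \<in> {0..<int p}" for u
  proof -
    have "u ^ 3 - u = u * ((u - 1) * (u + 1))" by (simp add: algebra_simps power3_eq_cube)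
    then have "int p dvd u ^ 3 - u \<longleftrightarrow> int p dvd u \<or> int p dvd u - 1 \<or> int p dvd u + 1"
      using prime_p by (simp add: prime_dvd_mult_iff)
    moreover have "int p dvd u \<longleftrightarrow> u = 0"
      using u by (auto dest: zdvd_imp_le simp: order_le_less)
    moreover have "int p dvd u - 1 \<longleftrightarrow> u = 1"
      using u p_gt_2 cong_less_imp_eq_int[of u p 1] by (auto simp: cong_iff_dvd_diff)
    moreover have "int p dvd u + 1 \<longleftrightarrow> u = int p - 1"
      using u zdvd_imp_le[of p "u + 1"] by auto
    ultimately show ?thesis by blast
  qed
  then have "{u \<in> {0..<int p}. int p dvd u ^ 3 - u} = {0, 1, int p - 1}"
    using p_gt_2 by auto
  then show ?thesis using p_gt_2 by simp
qed

end

theorem lemma2p6: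
  fixes p :: nat
  assumes "prime p" and "odd p"
  shows "first_moment family_E p = - 2 * int p"
proof -
  have "first_moment family_E p =
      - (\<Sum>t\<in>{0..<int p}. \<Sum>u\<in>{0..<int p}. Legendre t p * Legendre (t + (u ^ 3 - u)) p)"
    by (simp add: first_moment_def trace_at_eq_Legendre_sum[OF assms] fiber_Legendre_sum[OF assms] sum_negf)
  \<comment> \<open>With \<open>t\<close> as the inner variable, each \<open>u\<close> leaves a
    shifted sum with \<open>c = u ^ 3 - u\<close>.\<close>
  also have "\<dots> = - (\<Sum>u\<in>{0..<int p}. if int p dvd u ^ 3 - u then int p - 1 else - 1)"
    by (subst sum.swap) (simp only: sum_Legendre_shift[OF assms])
  \<comment> \<open>Every \<open>u\<close> contributes -1 and the three roots contribute
    \<open>p\<close> more each, so the sum is \<open>3 * p - p\<close>.\<close>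
  also have "\<dots> = - 2 * int p"
    using sum_residues_if_dvd[of p "\<lambda>u. u ^ 3 - u" "int p - 1" "- 1",
        unfolded card_roots_cube_minus_self[OF assms]]
    by simp
  finally show ?thesis .
qed

end
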